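(* Let $n\ge3$ and $0\le i\le n-1$, and let $W\subseteq R_{(1,n)}$ be a basepoint free three-dimensional subspace with a basis $\{g_0h_0,g_1h_1,g_2h_2\}$, where $g_j\in R_{(1,i)}$ and $h_j\in\mathbb K[u,v]_{n-i}$. Then: (1) $\{h_0,h_1,h_2\}$ and $\{g_0,g_1,g_2\}$ are basepoint free (the $h_j$ on $\mathbb P^1$, the $g_j$ on $\mathbb P^1\times\mathbb P^1$). (2) If $(a_0,a_1,a_2)$ is a syzygy on $(h_0,h_1,h_2)$, then $(g_1g_2a_0,\,g_0g_2a_1,\,g_0g_1a_2)$ is a (possibly non-minimal) syzygy on $I_W$, i.e. on $(g_0h_0,g_1h_1,g_2h_2)$; similarly, if $(c_0,c_1,c_2)$ is a syzygy on $(g_0,g_1,g_2)$, then $(h_1h_2c_0,\,h_0h_2c_1,\,h_0h_1c_2)$ is a syzygy on $I_W$. (3) If $\{h_0,h_1,h_2\}$ is a pencil, then there is a syzygy of bidegree $(3,2i+n)$ on $I_W$. (4) If $\{h_0,h_1,h_2\}$ is not a pencil, then it has a Hilbert–Burch matrix with columns of degrees $\{n-i-\mu,\mu\}$ in the $\{u,v\}$ variables (for some $\mu$), and its columns give rise, via the lifting in (2), to syzygies on $I_W$ of bidegrees $(3,n+2i+\mu)$ and $(3,2n+i-\mu)$.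
   Context: $\mathbb K$ is a field, $R=\mathbb K[s,t;u,v]$ is $\mathbb Z^2$-graded with $\deg s=\deg t=(1,0)$, $\deg u=\deg v=(0,1)$. For $W=\operatorname{Span}\{f_0,f_1,f_2\}$, $I_W=\langle f_0,f_1,f_2\rangle$; $W$ is basepoint free if $\sqrt{I_W}=\langle s,t\rangle\cap\langle u,v\rangle$. A set of sections is basepoint free if its members have no common zero over the algebraic closure of $\mathbb K$. A pencil means that the span of the $h_j$ has dimension two. A syzygy on $(f_0,f_1,f_2)$ whose entries have bidegree $\mathbf e$ has bidegree $\mathbf e+(1,n)$. The Hilbert–Burch matrix of $\{h_0,h_1,h_2\}$ is the $3\times2$ matrix whose columns are minimal homogeneous generators of the syzygies of $(h_0,h_1,h_2)$ over $\mathbb K[u,v]$; the degree of a column is the degree of its entries. *)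

theory Defs
  imports
    "HOL-Analysis.Analysis"
    "HOL-Library.Poly_Mapping"
    "HOL-Algebra.Algebraic_Closure_Type"
begin

datatype bivar = Var_s | Var_t | Var_u | Var_v

(* The order on the variables has no mathematical role here: through the library instances for
   Poly_Mapping it makes the polynomial ring below an instance of class idom. *)
fun bivar_index :: "bivar \<Rightarrow> nat" where
  "bivar_index Var_s = 0"
| "bivar_index Var_t = 1"
| "bivar_index Var_u = 2"
| "bivar_index Var_v = 3"

instantiation bivar :: linorder
begin

definition "x \<le> y \<longleftrightarrow> bivar_index x \<le> bivar_index y"
definition "x < y \<longleftrightarrow> bivar_index x < bivar_index y"

instance
proof
  fix x y :: bivar
  show "x \<le> y \<Longrightarrow> y \<le> x \<Longrightarrow> x = y"
    by (cases x; cases y; simp add: less_eq_bivar_def)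
qed (auto simp: less_eq_bivar_def less_bivar_def)

end

(* K[s,t;u,v]: finitely supported maps from exponent vectors to coefficients. *)
type_synonym 'a bipoly = "(bivar \<Rightarrow>\<^sub>0 nat) \<Rightarrow>\<^sub>0 'a"

definition var :: "bivar \<Rightarrow> 'a::field bipoly" where
  "var x = Poly_Mapping.single (Poly_Mapping.single x 1) 1"

definition kscale :: "'a::field \<Rightarrow> 'a bipoly \<Rightarrow> 'a bipoly" where
  "kscale c p = Poly_Mapping.single 0 c * p"

interpretation kvs: vector_space "kscale :: 'a::field \<Rightarrow> 'a bipoly \<Rightarrow> 'a bipoly"
  by unfold_locales
     (simp_all add: kscale_def algebra_simps single_add mult_single flip: mult.assoc single_one)

definition bidegree :: "(bivar \<Rightarrow>\<^sub>0 nat) \<Rightarrow> nat \<times> nat" where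
  "bidegree m = (Poly_Mapping.lookup m Var_s + Poly_Mapping.lookup m Var_t,
                 Poly_Mapping.lookup m Var_u + Poly_Mapping.lookup m Var_v)"

(* The graded piece R_e; it contains 0 for every e. *)
definition bihom :: "nat \<times> nat \<Rightarrow> 'a::field bipoly set" where
  "bihom e = {p. \<forall>m \<in> Poly_Mapping.keys p. bidegree m = e}"

(* K[u,v], as a subring of K[s,t;u,v]. *)
definition uv_polys :: "'a::field bipoly set" where
  "uv_polys = {p. \<forall>m \<in> Poly_Mapping.keys p.
                    Poly_Mapping.lookup m Var_s = 0 \<and> Poly_Mapping.lookup m Var_t = 0}"

definition uv_forms :: "nat \<Rightarrow> 'a::field bipoly set" where
  "uv_forms d = uv_polys \<inter> bihom (0, d)"

definition ideal_gen :: "'r::comm_ring_1 set \<Rightarrow> 'r set" where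
  "ideal_gen F = module.span (*) F"

definition ideal_radical :: "'r::comm_ring_1 set \<Rightarrow> 'r set" where
  "ideal_radical I = {p. \<exists>k. p ^ k \<in> I}"

(* I_W is generated by any K-basis of W, equivalently by W itself; see base_ideal_span. *)
definition base_ideal :: "'a::field bipoly set \<Rightarrow> 'a bipoly set" where
  "base_ideal W = ideal_gen W"

lemma base_ideal_span: "base_ideal (kvs.span F) = ideal_gen F"
proof -
  interpret rm: Modules.module "(*) :: 'a bipoly \<Rightarrow> 'a bipoly \<Rightarrow> 'a bipoly"
    by unfold_locales (simp_all add: algebra_simps)
  have "kvs.span F \<subseteq> rm.span F"
  proof
    fix x assume "x \<in> kvs.span F"
    then show "x \<in> rm.span F"
      by (induction rule: kvs.span_induct_alt)
         (auto simp: kscale_def intro: rm.span_zero rm.span_add rm.span_scale rm.span_base)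
  qed
  then have "rm.span (kvs.span F) \<subseteq> rm.span F"
    by (rule rm.span_minimal) (rule rm.subspace_span)
  moreover have "rm.span F \<subseteq> rm.span (kvs.span F)"
    by (rule rm.span_mono) (rule kvs.span_superset)
  ultimately show ?thesis
    by (auto simp: base_ideal_def ideal_gen_def)
qed

definition basepoint_free :: "'a::field bipoly set \<Rightarrow> bool" where
  "basepoint_free W \<longleftrightarrow>
     ideal_radical (base_ideal W) = ideal_gen {var Var_s, var Var_t} \<inter> ideal_gen {var Var_u, var Var_v}"

fun point :: "'b \<times> 'b \<Rightarrow> 'b \<times> 'b \<Rightarrow> bivar \<Rightarrow> 'b" where
  "point (a, b) (c, d) Var_s = a"
| "point (a, b) (c, d) Var_t = b"
| "point (a, b) (c, d) Var_u = c"
| "point (a, b) (c, d) Var_v = d"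

definition eval_ac :: "(bivar \<Rightarrow> 'a alg_closure) \<Rightarrow> 'a::field bipoly \<Rightarrow> 'a alg_closure" where
  "eval_ac x p = (\<Sum>m \<in> Poly_Mapping.keys p.
     to_ac (Poly_Mapping.lookup p m) * (\<Prod>y \<in> Poly_Mapping.keys m. x y ^ Poly_Mapping.lookup m y))"

(* Points of P^1 over the algebraic closure are given by nonzero coordinate pairs. *)
definition bpf_sections_P1xP1 :: "'a::field bipoly ^ 3 \<Rightarrow> bool" where
  "bpf_sections_P1xP1 f \<longleftrightarrow>
     (\<forall>P Q. P \<noteq> (0, 0) \<longrightarrow> Q \<noteq> (0, 0) \<longrightarrow> (\<exists>j. eval_ac (point P Q) (f $ j) \<noteq> 0))"

(* For sections in K[u,v]: the values given to s and t do not matter. *)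
definition bpf_sections_P1 :: "'a::field bipoly ^ 3 \<Rightarrow> bool" where
  "bpf_sections_P1 f \<longleftrightarrow>
     (\<forall>Q. Q \<noteq> (0, 0) \<longrightarrow> (\<exists>j. eval_ac (point (0, 0) Q) (f $ j) \<noteq> 0))"

definition pencil :: "'a::field bipoly ^ 3 \<Rightarrow> bool" where
  "pencil h \<longleftrightarrow> kvs.dim (kvs.span (range (($) h))) = 2"

definition syzygy :: "'r::comm_ring_1 ^ 3 \<Rightarrow> 'r ^ 3 \<Rightarrow> bool" where
  "syzygy f a \<longleftrightarrow> (\<Sum>j\<in>UNIV. a $ j * f $ j) = 0"

(* Bidegree of a syzygy on forms f_j of bidegree (1,n).  The zero syzygy is excluded: it would
   otherwise have every bidegree. *)
definition syzygy_of_bidegree ::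
    "nat \<Rightarrow> 'a::field bipoly ^ 3 \<Rightarrow> 'a bipoly ^ 3 \<Rightarrow> nat \<times> nat \<Rightarrow> bool" where
  "syzygy_of_bidegree n f a q \<longleftrightarrow>
     syzygy f a \<and> a \<noteq> 0 \<and> (\<exists>e. (\<forall>j. a $ j \<in> bihom e) \<and> q = e + (1, n))"

definition products :: "'r::comm_ring_1 ^ 3 \<Rightarrow> 'r ^ 3 \<Rightarrow> 'r ^ 3" where
  "products g h = (\<chi> j. g $ j * h $ j)"

(* (g_1 g_2 a_0, g_0 g_2 a_1, g_0 g_1 a_2) *)
definition lift_syzygy :: "'r::comm_ring_1 ^ 3 \<Rightarrow> 'r ^ 3 \<Rightarrow> 'r ^ 3" where
  "lift_syzygy g a = (\<chi> j. (\<Prod>k \<in> UNIV - {j}. g $ k) * a $ j)"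

definition uv_syzygies :: "'a::field bipoly ^ 3 \<Rightarrow> ('a bipoly ^ 3) set" where
  "uv_syzygies h = {a. (\<forall>j. a $ j \<in> uv_polys) \<and> syzygy h a}"

(* The K[u,v]-submodule generated by the columns of M with index in J. *)
definition uv_column_span :: "'a::field bipoly ^ 2 ^ 3 \<Rightarrow> 2 set \<Rightarrow> ('a bipoly ^ 3) set" where
  "uv_column_span M J = {(\<Sum>k\<in>J. p k *s column k M) | p. \<forall>k. p k \<in> uv_polys}"

definition column_of_degree :: "'a::field bipoly ^ 2 ^ 3 \<Rightarrow> 2 \<Rightarrow> nat \<Rightarrow> bool" where
  "column_of_degree M k d \<longleftrightarrow> (\<forall>j. column k M $ j \<in> uv_forms d)"

(* Minimality of the generators: no proper subset of the columns generates.  In particular both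
   columns are nonzero, so each has a unique degree. *)
definition hilbert_burch_matrix :: "'a::field bipoly ^ 3 \<Rightarrow> 'a bipoly ^ 2 ^ 3 \<Rightarrow> bool" where
  "hilbert_burch_matrix h M \<longleftrightarrow>
     (\<forall>k. \<exists>d. column_of_degree M k d) \<and>
     uv_column_span M UNIV = uv_syzygies h \<and>
     (\<forall>J. J \<subset> UNIV \<longrightarrow> uv_column_span M J \<noteq> uv_syzygies h)"

end

theory Submission
  imports Defs
begin

text \<open>
  Write \<open>f_j = g_j h_j\<close>.  The point of the proof is the Hilbert-Burch matrix in part (4); the rest
  is evaluation and linear algebra.

  Part (1): at a point of \<open>P^1 x P^1\<close>, one of the bihomogeneous coordinates \<open>s\<close>, \<open>t\<close> and one of
  \<open>u\<close>, \<open>v\<close> is nonzero.  A power of their product lies in \<open>I_W\<close>, so some \<open>f_j\<close>, hence both of its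
  factors, is nonzero there (\<open>basepoint_free_no_common_zero\<close>).  Part (2) is the identity
  \<open>(\<Prod>k\<noteq>j. g_k) a_j f_j = (\<Prod>k. g_k) a_j h_j\<close>, summed over \<open>j\<close>.  For part (3), a pencil has a linear
  relation with constant coefficients, and this relation is lifted.

  For part (4), let \<open>d = n - i\<close>.  The cross product \<open>p \<times> q\<close> of two vectors is orthogonal to both, so
  that \<open>p\<close> and \<open>q\<close> are syzygies on \<open>p \<times> q\<close>.  The columns of the matrix are therefore sought as
  vectors \<open>p\<close>, \<open>q\<close> of forms with \<open>p \<times> q = h\<close>, and the degrees of such forms add up to \<open>d\<close>.

  They exist (\<open>mu_basis_poly\<close>): put \<open>v = 1\<close>, so that \<open>h\<close> becomes a vector of polynomials in one
  variable.  The Bezout identity for its first two entries gives polynomial vectors with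
  \<open>p \<times> q = h\<close>.  Replacing \<open>q\<close> by \<open>q - c p\<close> does not change the cross product, and as long as the
  degree bounds of \<open>p\<close> and \<open>q\<close> add up to more than \<open>d\<close>, the vectors of top coefficients are linearly
  dependent, so that such a step lowers one of the bounds.  When the sum has come down to \<open>d\<close>,
  homogenizing \<open>p\<close> and \<open>q\<close> gives forms whose cross product is the original \<open>h\<close>.

  They generate (\<open>hilbert_burch_matrix_if_cross\<close>): the cross product of any two syzygies on \<open>h\<close> is
  proportional to \<open>h\<close>, and even a multiple of \<open>h\<close> over \<open>K[u,v]\<close>, because the ideal of the \<open>h_j\<close>
  contains powers of \<open>u\<close> and of \<open>v\<close> (\<open>proportional_imp_multiple\<close>).  So for a syzygy \<open>a\<close> the
  coefficients of \<open>p\<close> and \<open>q\<close> that Cramer's rule provides lie in \<open>K[u,v]\<close>.  The powers of \<open>u\<close> and \<open>v\<close>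
  are obtained from the powers of \<open>s u\<close> and \<open>s v\<close> in \<open>I_W\<close> by setting \<open>s = 1\<close> and \<open>t = 0\<close>
  (\<open>var_power_in_uv_ideal\<close>).
\<close>

\<comment> \<open>Polynomials in one variable are those of type \<open>'a poly\<close>, and the dollar sign selects vector
  components; other polynomial rings and formal power series compete for these names.\<close>
no_notation fps_nth (infixl "$" 75)
hide_const (open) Polynomials.degree up_ring.coeff up_ring.monom

section \<open>Cross products and syzygies of three elements\<close>

definition cross :: "'r::comm_ring_1 ^ 3 \<Rightarrow> 'r ^ 3 \<Rightarrow> 'r ^ 3" where
  "cross a b = vector [a $ 2 * b $ 3 - a $ 3 * b $ 2,
                       a $ 3 * b $ 1 - a $ 1 * b $ 3,
                       a $ 1 * b $ 2 - a $ 2 * b $ 1]"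

lemma cross_nth [simp]:
  "cross a b $ 1 = a $ 2 * b $ 3 - a $ 3 * b $ 2"
  "cross a b $ 2 = a $ 3 * b $ 1 - a $ 1 * b $ 3"
  "cross a b $ 3 = a $ 1 * b $ 2 - a $ 2 * b $ 1"
  by (simp_all add: cross_def)

lemma vec3_eq_iff: "x = y \<longleftrightarrow> x $ 1 = y $ 1 \<and> x $ 2 = y $ 2 \<and> x $ 3 = (y :: 'r ^ 3) $ 3"
  by (simp add: vec_eq_iff forall_3)

lemma vec3_neq_0:
  fixes h :: "'r::zero ^ 3"
  assumes "h \<noteq> 0"
  obtains j where "h $ j \<noteq> 0"
  using assms by (auto simp: vec_eq_iff)

lemma syzygy_iff: "syzygy h a \<longleftrightarrow> a $ 1 * h $ 1 + a $ 2 * h $ 2 + a $ 3 * h $ 3 = 0"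
  by (simp add: syzygy_def sum_3)

lemma syzygy_cross: "syzygy (cross p q) p" "syzygy (cross p q) q"
  by (simp_all add: syzygy_iff algebra_simps)

lemma syzygy_add: "syzygy h a \<Longrightarrow> syzygy h b \<Longrightarrow> syzygy h (a + b)"
  by (simp add: syzygy_def algebra_simps sum.distrib)

lemma syzygy_scale: "syzygy h a \<Longrightarrow> syzygy h (c *s a)"
  by (simp add: syzygy_def mult.assoc flip: sum_distrib_left)

lemma cross_parallel: "cross (c *s a) (d *s a) = 0"
  by (simp add: vec3_eq_iff algebra_simps)

text \<open>
  The two moves that reduce the degrees of \<open>p\<close> and \<open>q\<close> below: both keep the cross product.
\<close>

lemma cross_swap: "cross q (- p) = cross p q"
  by (simp add: vec3_eq_iff algebra_simps)

lemma cross_shear: "cross p (q - c *s p) = cross p q"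
  by (simp add: vec3_eq_iff algebra_simps)

text \<open>
  The double cross product \<open>h \<times> (a \<times> b) = (h \<cdot> b) a - (h \<cdot> a) b\<close> vanishes when \<open>a\<close> and \<open>b\<close> are
  orthogonal to \<open>h\<close>.
\<close>

lemma cross_syzygies_proportional:
  assumes "syzygy h a" "syzygy h b"
  shows "h $ i * cross a b $ j = h $ j * cross a b $ i"
proof -
  have expand: "cross h (cross a b) = (\<Sum>j\<in>UNIV. b $ j * h $ j) *s a - (\<Sum>j\<in>UNIV. a $ j * h $ j) *s b"
    by (simp add: vec3_eq_iff sum_3 algebra_simps)
  have "cross h (cross a b) = 0"
    using assms unfolding expand by (simp add: syzygy_def)
  then show ?thesis
    using exhaust_3[of i] exhaust_3[of j] unfolding vec3_eq_iff
    by (elim disjE) (simp_all del: cross_nth add: cross_nth[of h])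
qed

text \<open>
  Cramer's rule for the four vectors \<open>a\<close>, \<open>p\<close>, \<open>q\<close> and the \<open>j\<close>-th unit vector in three-space.  The
  coefficient of the unit vector is the determinant of \<open>a\<close>, \<open>p\<close>, \<open>q\<close>, that is \<open>a \<cdot> (p \<times> q)\<close>, which is
  zero because \<open>a\<close> is a syzygy on \<open>p \<times> q\<close>.
\<close>

lemma cramer:
  assumes "syzygy (cross p q) a"
  shows "cross p q $ j * a $ i = cross a q $ j * p $ i + cross p a $ j * q $ i"
proof -
  have "cross p q $ j * a $ i = cross a q $ j * p $ i + cross p a $ j * q $ i
          + (if i = j then (\<Sum>j\<in>UNIV. a $ j * cross p q $ j) else 0)"
    using exhaust_3[of i] exhaust_3[of j] by (elim disjE) (simp_all add: sum_3 algebra_simps)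
  then show ?thesis
    using assms by (simp add: syzygy_def)
qed

text \<open>
  Over the fraction field, \<open>p\<close> and \<open>q\<close> span the plane orthogonal to \<open>h\<close>.  If the two cross products
  with \<open>a\<close> are multiples of \<open>h\<close>, a component of \<open>h\<close> cancels from Cramer's rule, and no denominators
  remain.
\<close>

lemma syzygy_combination:
  fixes h :: "'r::idom ^ 3"
  assumes "h \<noteq> 0" "cross p q = h" "syzygy h a" "cross a q = \<alpha> *s h" "cross p a = \<beta> *s h"
  shows "a = \<alpha> *s p + \<beta> *s q"
proof -
  obtain j where j: "h $ j \<noteq> 0"
    using assms(1) by (rule vec3_neq_0)
  have "a $ i = \<alpha> * p $ i + \<beta> * q $ i" for i
  proof -
    have "h $ j * a $ i = h $ j * (\<alpha> * p $ i + \<beta> * q $ i)"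
      using cramer[of p q a j i] assms by (simp add: algebra_simps)
    with j show ?thesis by simp
  qed
  then show ?thesis by (simp add: vec_eq_iff)
qed

lemma vec3_parallel:
  fixes a b :: "'k::field ^ 3"
  assumes "cross a b = 0" "a \<noteq> 0"
  obtains c where "b = c *s a"
proof -
  obtain j where j: "a $ j \<noteq> 0"
    using assms(2) by (rule vec3_neq_0)
  have "a $ j * b $ i = b $ j * a $ i" for i
    using assms(1) exhaust_3[of i] exhaust_3[of j] unfolding vec3_eq_iff
    by (elim disjE) (simp_all add: algebra_simps)
  then have "b = (b $ j / a $ j) *s a"
    using j by (simp add: vec_eq_iff field_simps)
  then show ?thesis by (rule that)
qed

section \<open>The syzygies on three univariate polynomials\<close>

text \<open>
  The Euclidean algorithm, run on the cofactors.  Making the identity hold for \<open>x'\<close> and \<open>y'\<close>, not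
  for \<open>x\<close> and \<open>y\<close>, covers the case \<open>x = y = 0\<close>, where \<open>g = 0\<close>, \<open>x' = 1\<close> and \<open>y' = 0\<close>.
\<close>

lemma poly_bezout:
  fixes x y :: "'k::field poly"
  shows "\<exists>g x' y' \<alpha> \<beta>. x = g * x' \<and> y = g * y' \<and> \<alpha> * x' + \<beta> * y' = 1"
proof (induction "if y = 0 then 0 else Suc (degree y)" arbitrary: x y rule: less_induct)
  case less
  show ?case
  proof (cases "y = 0")
    case True
    then show ?thesis
      by (intro exI[of _ x] exI[of _ 1] exI[of _ 0]) simp
  next
    case False
    have "(if x mod y = 0 then 0 else Suc (degree (x mod y))) < (if y = 0 then 0 else Suc (degree y))"
      using False degree_mod_less'[of y x] by auto
    from less[OF this] obtain g b c \<alpha> \<beta>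
      where *: "y = g * b" "x mod y = g * c" "\<alpha> * b + \<beta> * c = 1"
      by blast
    have "x = g * (x div y * b + c)"
      using div_mult_mod_eq[of x y] *(1,2) by (simp add: algebra_simps)
    moreover have "\<beta> * (x div y * b + c) + (\<alpha> - \<beta> * (x div y)) * b = 1"
      using *(3) by (simp add: algebra_simps)
    ultimately show ?thesis using *(1) by blast
  qed
qed

text \<open>
  Let \<open>h_1 = g x\<close> and \<open>h_2 = g y\<close> as above.  Take for \<open>p\<close> the Koszul relation \<open>(- y, x, 0)\<close> between
  the first two entries, divided by \<open>g\<close>.  Then \<open>p \<times> q = h\<close> asks for \<open>q_3 = g\<close> and
  \<open>x q_1 + y q_2 = - h_3\<close>, and the Bezout identity solves the latter.
\<close>

lemma cross_surj_poly:
  fixes h :: "'k::field poly ^ 3"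
  obtains p q where "cross p q = h"
proof -
  obtain g x y \<alpha> \<beta> where h: "h $ 1 = g * x" "h $ 2 = g * y" and one: "\<alpha> * x + \<beta> * y = 1"
    using poly_bezout by blast
  have "cross (vector [- y, x, 0]) (vector [- \<alpha> * h $ 3, - \<beta> * h $ 3, g]) = h"
  proof -
    have "h $ 3 = (\<alpha> * x + \<beta> * y) * h $ 3" by (simp add: one)
    then show ?thesis
      using h by (simp add: vec3_eq_iff algebra_simps)
  qed
  then show ?thesis by (rule that)
qed

lemma coeff_mult_top:
  fixes p q :: "'k::comm_semiring_1 poly"
  assumes "degree p \<le> e" "degree q \<le> f"
  shows "coeff (p * q) (e + f) = coeff p e * coeff q f"
proof -
  have "(\<Sum>i\<le>e + f. coeff p i * coeff q (e + f - i)) = (\<Sum>i\<in>{e}. coeff p i * coeff q (e + f - i))"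
  proof (rule sum.mono_neutral_right)
    show "\<forall>i\<in>{..e + f} - {e}. coeff p i * coeff q (e + f - i) = 0"
    proof
      fix i assume "i \<in> {..e + f} - {e}"
      then have "i > e \<or> e + f - i > f" by auto
      then show "coeff p i * coeff q (e + f - i) = 0"
        using assms by (auto simp: coeff_eq_0)
    qed
  qed auto
  then show ?thesis by (simp add: coeff_mult)
qed

lemma degree_less_if_coeff_0: "degree p \<le> e \<Longrightarrow> coeff p e = 0 \<Longrightarrow> e \<noteq> 0 \<Longrightarrow> degree p \<le> e - 1"
  using eq_zero_or_degree_less[of p e] by auto

text \<open>
  The coefficient of \<open>p \<times> q\<close> in degree \<open>e + f\<close> is the cross product of the vectors \<open>A\<close> and \<open>B\<close> of top
  coefficients.  If it vanishes, then either \<open>A = 0\<close> and the bound on \<open>p\<close> was not sharp, or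
  \<open>B = c A\<close> and subtracting \<open>c x^(f - e) p\<close> from \<open>q\<close> removes the top coefficients of \<open>q\<close>.
\<close>

lemma shear_reduces_degrees:
  fixes h p q :: "'k::field poly ^ 3"
  assumes cross: "cross p q = h" and "h \<noteq> 0" and "e \<le> f" "f \<noteq> 0"
    and deg_p: "\<And>j. degree (p $ j) \<le> e" and deg_q: "\<And>j. degree (q $ j) \<le> f"
    and top: "\<And>j. coeff (h $ j) (e + f) = 0"
  shows "\<exists>p' q' e' f'. cross p' q' = h \<and> e' + f' < e + f \<and>
           (\<forall>j. degree (p' $ j) \<le> e') \<and> (\<forall>j. degree (q' $ j) \<le> f')"
proof -
  define A where "A = (\<chi> j. coeff (p $ j) e)"
  define B where "B = (\<chi> j. coeff (q $ j) f)"
  have "cross A B $ j = coeff (h $ j) (e + f)" for j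
    using exhaust_3[of j] deg_p deg_q coeff_mult_top[of "q $ k" f "p $ l" e for k l]
    by (auto simp: A_def B_def coeff_mult_top add.commute simp flip: cross)
  then have AB: "cross A B = 0"
    using top by (simp add: vec_eq_iff)
  show ?thesis
  proof (cases "A = 0")
    case True
    then have A0: "coeff (p $ j) e = 0" for j
      by (simp add: A_def vec_eq_iff)
    have "e \<noteq> 0"
    proof
      assume "e = 0"
      then have "p = 0"
        using A0 deg_p by (metis degree_eq_zeroE coeff_pCons_0 le_zero_eq pCons_0_0 vec_eq_iff zero_index)
      then have "cross p q = 0"
        by (simp add: vec3_eq_iff)
      with cross \<open>h \<noteq> 0\<close> show False by simp
    qed
    moreover from this have "degree (p $ j) \<le> e - 1" for j
      using degree_less_if_coeff_0 A0 deg_p by blast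
    ultimately show ?thesis
      using cross deg_q by (intro exI[of _ p] exI[of _ q] exI[of _ "e - 1"] exI[of _ f]) auto
  next
    case False
    then obtain c where c: "B = c *s A"
      using AB vec3_parallel by blast
    define q' where "q' = q - monom c (f - e) *s p"
    have "degree (q' $ j) \<le> f - 1" for j
    proof (rule degree_less_if_coeff_0)
      have "degree (monom c (f - e) * p $ j) \<le> (f - e) + e"
        by (rule order_trans[OF degree_mult_le add_mono[OF degree_monom_le deg_p]])
      then show "degree (q' $ j) \<le> f"
        using deg_q \<open>e \<le> f\<close> by (simp add: q'_def degree_diff_le)
      show "coeff (q' $ j) f = 0"
        using c \<open>e \<le> f\<close> by (simp add: q'_def A_def B_def vec_eq_iff coeff_monom_mult)
    qed fact
    moreover have "cross p q' = h"
      using cross by (simp add: q'_def cross_shear)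
    ultimately show ?thesis
      using deg_p \<open>f \<noteq> 0\<close> by (intro exI[of _ p] exI[of _ q'] exI[of _ e] exI[of _ "f - 1"]) auto
  qed
qed

lemma degree_cross_le:
  fixes p q :: "'k::comm_ring_1 poly ^ 3"
  assumes "\<And>j. degree (p $ j) \<le> e" "\<And>j. degree (q $ j) \<le> f"
  shows "degree (cross p q $ j) \<le> e + f"
proof -
  have "degree (p $ k * q $ l) \<le> e + f" for k l
    by (rule order_trans[OF degree_mult_le add_mono[OF assms]])
  then show ?thesis
    using exhaust_3[of j] by (elim disjE) (simp_all add: degree_diff_le)
qed

text \<open>
  Among the pairs with cross product \<open>h\<close>, the sum \<open>e + f\<close> of the degree bounds cannot be less than
  \<open>d\<close>, since \<open>h\<close> has degree \<open>d\<close>.  While it is greater, the coefficients of \<open>h\<close> in degree \<open>e + f\<close>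
  are zero, and the previous lemma applies to \<open>(p, q)\<close> or to \<open>(q, - p)\<close>, whichever has the smaller
  bound first.  Such a pair is a mu-basis of the syzygies on \<open>h\<close>.
\<close>

lemma mu_basis_poly:
  fixes h :: "'k::field poly ^ 3"
  assumes deg: "\<And>j. degree (h $ j) \<le> d" and top: "coeff (h $ j0) d \<noteq> 0"
  obtains p q e f where "cross p q = h" "e + f = d"
    "\<forall>j. degree (p $ j) \<le> e" "\<forall>j. degree (q $ j) \<le> f"
proof -
  have reduce: "\<exists>p q e f. cross p q = h \<and> e + f = d \<and> (\<forall>j. degree (p $ j) \<le> e) \<and> (\<forall>j. degree (q $ j) \<le> f)"
    if "cross p q = h" "\<And>j. degree (p $ j) \<le> e" "\<And>j. degree (q $ j) \<le> f" for p q e f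
    using that
  proof (induction "e + f" arbitrary: p q e f rule: less_induct)
    case less
    have "d \<le> e + f"
      using le_degree[OF top] degree_cross_le[OF less.prems(2,3)] less.prems(1) order_trans by metis
    show ?case
    proof (cases "e + f = d")
      case True
      then show ?thesis using less.prems by blast
    next
      case False
      with \<open>d \<le> e + f\<close> have "d < e + f" by simp
      then have vanish: "coeff (h $ j) (e + f) = 0" for j
        using deg le_less_trans coeff_eq_0 by metis
      have "h \<noteq> 0"
        using top by auto
      have "\<exists>p' q' e' f'. cross p' q' = h \<and> e' + f' < e + f \<and>
           (\<forall>j. degree (p' $ j) \<le> e') \<and> (\<forall>j. degree (q' $ j) \<le> f')"
      proof (cases "e \<le> f")
        case True
        with shear_reduces_degrees[OF less.prems(1) \<open>h \<noteq> 0\<close> True _ less.prems(2,3) vanish]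
          \<open>d < e + f\<close> show ?thesis by fastforce
      next
        case False
        with shear_reduces_degrees[of q "- p" h f e] less.prems \<open>h \<noteq> 0\<close> vanish
        show ?thesis by (simp add: cross_swap add.commute)
      qed
      then show ?thesis
        using less.hyps by blast
    qed
  qed
  obtain p q where "cross p q = h"
    by (rule cross_surj_poly)
  moreover have "degree (r $ j) \<le> (\<Sum>j\<in>UNIV. degree (r $ j))" for r :: "'k poly ^ 3" and j
    by (rule member_le_sum) auto
  ultimately obtain p' q' e f where "cross p' q' = h" "e + f = d"
    "\<forall>j. degree (p' $ j) \<le> e" "\<forall>j. degree (q' $ j) \<le> f"
    using reduce[of p q] by metis
  then show ?thesis
    by (rule that)
qed

section \<open>Monomials\<close>

lemma UNIV_bivar: "(UNIV :: bivar set) = {Var_s, Var_t, Var_u, Var_v}"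
  using bivar.exhaust by auto

instance bivar :: finite
  by standard (simp add: UNIV_bivar)

lemma sum_singles: "(\<Sum>m\<in>Poly_Mapping.keys p. Poly_Mapping.single m (Poly_Mapping.lookup p m)) = p"
  by (rule poly_mapping_eqI)
     (simp add: lookup_sum lookup_single when_def in_keys_iff flip: sum.inter_filter)

lemma lookup_single_mult:
  fixes w m :: "bivar \<Rightarrow>\<^sub>0 nat" and p :: "'a::field bipoly"
  shows "Poly_Mapping.lookup (Poly_Mapping.single w 1 * p) (w + m) = Poly_Mapping.lookup p m"
proof -
  have "Poly_Mapping.single w 1 * p
      = Poly_Mapping.single w 1 * (\<Sum>m\<in>Poly_Mapping.keys p. Poly_Mapping.single m (Poly_Mapping.lookup p m))"
    by (simp only: sum_singles)
  also have "\<dots> = (\<Sum>m\<in>Poly_Mapping.keys p. Poly_Mapping.single (w + m) (Poly_Mapping.lookup p m))"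
    by (simp add: sum_distrib_left mult_single)
  finally show ?thesis
    by (simp add: lookup_sum lookup_single when_def in_keys_iff)
qed

definition uvmon :: "nat \<Rightarrow> nat \<Rightarrow> bivar \<Rightarrow>\<^sub>0 nat" where
  "uvmon k l = Poly_Mapping.single Var_u k + Poly_Mapping.single Var_v l"

lemma lookup_uvmon [simp]:
  "Poly_Mapping.lookup (uvmon k l) Var_s = 0" "Poly_Mapping.lookup (uvmon k l) Var_t = 0"
  "Poly_Mapping.lookup (uvmon k l) Var_u = k" "Poly_Mapping.lookup (uvmon k l) Var_v = l"
  by (simp_all add: uvmon_def lookup_add lookup_single)

lemma uvmon_eq_iff:
  "uvmon k l = m \<longleftrightarrow> Poly_Mapping.lookup m Var_s = 0 \<and> Poly_Mapping.lookup m Var_t = 0 \<and>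
     Poly_Mapping.lookup m Var_u = k \<and> Poly_Mapping.lookup m Var_v = l"
proof
  assume *: "Poly_Mapping.lookup m Var_s = 0 \<and> Poly_Mapping.lookup m Var_t = 0 \<and>
     Poly_Mapping.lookup m Var_u = k \<and> Poly_Mapping.lookup m Var_v = l"
  show "uvmon k l = m"
  proof (rule poly_mapping_eqI)
    show "Poly_Mapping.lookup (uvmon k l) y = Poly_Mapping.lookup m y" for y
      using * by (cases y) simp_all
  qed
qed auto

lemma uvmon_add: "uvmon k l + uvmon k' l' = uvmon (k + k') (l + l')"
  by (subst eq_commute, subst uvmon_eq_iff) (simp add: lookup_add)

lemma var_power: "var y ^ k = Poly_Mapping.single (Poly_Mapping.single y k) 1"
  by (induction k) (simp_all add: var_def mult_single flip: single_add)

lemma var_power_neq_0: "var y ^ N \<noteq> 0"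
proof -
  have "Poly_Mapping.lookup (Poly_Mapping.single m (1 :: 'a)) m \<noteq> Poly_Mapping.lookup 0 m"
    for m :: "bivar \<Rightarrow>\<^sub>0 nat"
    by simp
  then show "(var y :: 'a::field bipoly) ^ N \<noteq> 0"
    unfolding var_power by metis
qed

section \<open>Evaluation of bigraded polynomials\<close>

text \<open>
  Coefficients are sent along \<open>\<phi>\<close> and variables to \<open>x\<close>.  With \<open>to_ac\<close> this is evaluation at a point
  over the algebraic closure; with the embedding of constants it is substitution of polynomials for
  the variables.
\<close>

definition eval_along ::
    "('a::field \<Rightarrow> 'b::comm_ring_1) \<Rightarrow> (bivar \<Rightarrow> 'b) \<Rightarrow> 'a bipoly \<Rightarrow> 'b" where
  "eval_along \<phi> x p = (\<Sum>m\<in>Poly_Mapping.keys p.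
     \<phi> (Poly_Mapping.lookup p m) * (\<Prod>y\<in>Poly_Mapping.keys m. x y ^ Poly_Mapping.lookup m y))"

lemma eval_ac_eq_eval_along: "eval_ac = eval_along to_ac"
  by (simp add: fun_eq_iff eval_ac_def eval_along_def)

lemma prod_keys:
  "(\<Prod>y\<in>Poly_Mapping.keys m. x y ^ Poly_Mapping.lookup m y)
    = (\<Prod>y\<in>UNIV. (x y :: 'b::comm_ring_1) ^ Poly_Mapping.lookup m (y :: bivar))"
  by (rule prod.mono_neutral_left) (auto simp: in_keys_iff)

locale coefficient_hom =
  fixes \<phi> :: "'a::field \<Rightarrow> 'b::comm_ring_1"
  assumes hom_zero [simp]: "\<phi> 0 = 0"
    and hom_one [simp]: "\<phi> 1 = 1"
    and hom_add: "\<phi> (c + d) = \<phi> c + \<phi> d"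
    and hom_mult: "\<phi> (c * d) = \<phi> c * \<phi> d"
begin

lemma eval_single:
  "eval_along \<phi> x (Poly_Mapping.single m c) = \<phi> c * (\<Prod>y\<in>UNIV. x y ^ Poly_Mapping.lookup m y)"
  by (simp add: eval_along_def prod_keys)

lemma eval_add: "eval_along \<phi> x (p + q) = eval_along \<phi> x p + eval_along \<phi> x q"
proof -
  have *: "eval_along \<phi> x r = (\<Sum>m\<in>Poly_Mapping.keys p \<union> Poly_Mapping.keys q.
      \<phi> (Poly_Mapping.lookup r m) * (\<Prod>y\<in>UNIV. x y ^ Poly_Mapping.lookup m y))"
    if "Poly_Mapping.keys r \<subseteq> Poly_Mapping.keys p \<union> Poly_Mapping.keys q" for r
    unfolding eval_along_def prod_keys
    using that by (intro sum.mono_neutral_left) (auto simp: in_keys_iff)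
  show ?thesis
    using *[of p] *[of q] *[OF keys_add]
    by (simp add: lookup_add hom_add algebra_simps sum.distrib)
qed

lemma eval_zero [simp]: "eval_along \<phi> x 0 = 0"
  by (simp add: eval_along_def)

lemma eval_sum: "eval_along \<phi> x (\<Sum>i\<in>A. f i) = (\<Sum>i\<in>A. eval_along \<phi> x (f i))"
  by (induction A rule: infinite_finite_induct) (simp_all add: eval_add)

lemma eval_one [simp]: "eval_along \<phi> x 1 = 1"
  using eval_single[of x 0 1] by simp

lemma eval_mult: "eval_along \<phi> x (p * q) = eval_along \<phi> x p * eval_along \<phi> x q"
proof -
  let ?mon = "\<lambda>p m. Poly_Mapping.single m (Poly_Mapping.lookup p m)"
  have single: "eval_along \<phi> x (Poly_Mapping.single m c * Poly_Mapping.single m' c')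
      = eval_along \<phi> x (Poly_Mapping.single m c) * eval_along \<phi> x (Poly_Mapping.single m' c')" for m c m' c'
    by (simp add: mult_single eval_single hom_mult lookup_add power_add prod.distrib algebra_simps)
  have "eval_along \<phi> x ((\<Sum>m\<in>Poly_Mapping.keys p. ?mon p m) * (\<Sum>m\<in>Poly_Mapping.keys q. ?mon q m))
      = eval_along \<phi> x (\<Sum>m\<in>Poly_Mapping.keys p. ?mon p m)
        * eval_along \<phi> x (\<Sum>m\<in>Poly_Mapping.keys q. ?mon q m)"
    by (simp only: sum_product eval_sum single)
  then show ?thesis
    by (simp only: sum_singles)
qed

lemma eval_power: "eval_along \<phi> x (p ^ k) = eval_along \<phi> x p ^ k"
  by (induction k) (simp_all add: eval_mult)

lemma eval_var: "eval_along \<phi> x (var y) = x y"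
proof -
  have "(\<Prod>z\<in>UNIV. x z ^ (1 when y = z)) = (\<Prod>z\<in>UNIV. if z = y then x z else 1)"
    by (rule prod.cong) (auto simp: when_def)
  then show ?thesis
    by (simp add: var_def eval_single lookup_single)
qed

end

interpretation to_ac: coefficient_hom to_ac
  by unfold_locales simp_all

interpretation const: coefficient_hom "Poly_Mapping.single 0 :: 'a::field \<Rightarrow> 'a bipoly"
  by unfold_locales (simp_all add: single_add mult_single)

section \<open>Generated ideals\<close>

lemma module_mult: "Modules.module ((*) :: 'r::comm_ring_1 \<Rightarrow> 'r \<Rightarrow> 'r)"
  by unfold_locales (simp_all add: algebra_simps)

lemma ideal_gen_superset: "F \<subseteq> ideal_gen F"
  unfolding ideal_gen_def by (rule module.span_superset[OF module_mult])

lemma ideal_gen_mult: "x \<in> ideal_gen F \<Longrightarrow> r * x \<in> ideal_gen F"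
  unfolding ideal_gen_def by (rule module.span_scale[OF module_mult])

lemma ideal_gen_induct [consumes 1, case_names zero add mult base]:
  assumes "x \<in> ideal_gen F" "P 0" "\<And>x y. P x \<Longrightarrow> P y \<Longrightarrow> P (x + y)" "\<And>r x. P x \<Longrightarrow> P (r * x)"
    "\<And>x. x \<in> F \<Longrightarrow> P x"
  shows "P x"
proof -
  have "ideal_gen F \<subseteq> {x. P x}"
    unfolding ideal_gen_def
    by (rule module.span_minimal[OF module_mult])
       (use assms in \<open>auto simp: module.subspace_def[OF module_mult]\<close>)
  with assms(1) show ?thesis by blast
qed

lemma (in coefficient_hom) eval_ideal_gen_eq_0:
  assumes "p \<in> ideal_gen F" "\<And>f. f \<in> F \<Longrightarrow> eval_along \<phi> x f = 0"
  shows "eval_along \<phi> x p = 0"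
  using assms(1) by (induction rule: ideal_gen_induct) (simp_all add: eval_add eval_mult assms(2))

lemma basepoint_free_power:
  fixes W :: "'a::field bipoly set"
  assumes "basepoint_free W" "a \<in> {Var_s, Var_t}" "b \<in> {Var_u, Var_v}"
  obtains N where "(var a * var b) ^ N \<in> base_ideal W"
proof -
  have "(var a :: 'a bipoly) \<in> ideal_gen {var Var_s, var Var_t}" "(var b :: 'a bipoly) \<in> ideal_gen {var Var_u, var Var_v}"
    using assms(2,3) by (auto intro!: ideal_gen_superset[THEN subsetD])
  then have "(var b * var a :: 'a bipoly) \<in> ideal_gen {var Var_s, var Var_t}"
    "(var a * var b :: 'a bipoly) \<in> ideal_gen {var Var_u, var Var_v}"
    by (simp_all add: ideal_gen_mult)
  then have "var a * var b \<in> ideal_radical (base_ideal W)"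
    using assms(1) by (simp add: basepoint_free_def mult.commute)
  then show ?thesis
    using that by (auto simp: ideal_radical_def)
qed

section \<open>Polynomials in u and v\<close>

lemma uv_polys_zero [simp]: "0 \<in> uv_polys" and uv_polys_one [simp]: "1 \<in> uv_polys"
  by (auto simp: uv_polys_def)

lemma uv_polys_add: "p \<in> uv_polys \<Longrightarrow> q \<in> uv_polys \<Longrightarrow> p + q \<in> uv_polys"
  using keys_add[of p q] by (auto simp: uv_polys_def)

lemma uv_polys_mult: "p \<in> uv_polys \<Longrightarrow> q \<in> uv_polys \<Longrightarrow> p * q \<in> uv_polys"
  using keys_mult[of p q] by (fastforce simp: uv_polys_def lookup_add)

lemma uv_polys_uminus: "p \<in> uv_polys \<Longrightarrow> - p \<in> uv_polys"
  by (auto simp: uv_polys_def in_keys_iff)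

lemma uv_polys_diff: "p \<in> uv_polys \<Longrightarrow> q \<in> uv_polys \<Longrightarrow> p - q \<in> uv_polys"
  using uv_polys_add[OF _ uv_polys_uminus, of p q] by simp

lemma uv_polys_sum: "(\<And>i. i \<in> A \<Longrightarrow> f i \<in> uv_polys) \<Longrightarrow> sum f A \<in> uv_polys"
  by (induction A rule: infinite_finite_induct) (auto intro: uv_polys_add)

lemma uv_polys_prod: "(\<And>i. i \<in> A \<Longrightarrow> f i \<in> uv_polys) \<Longrightarrow> prod f A \<in> uv_polys"
  by (induction A rule: infinite_finite_induct) (auto intro: uv_polys_mult)

lemma uv_polys_power: "p \<in> uv_polys \<Longrightarrow> p ^ k \<in> uv_polys"
  by (induction k) (auto intro: uv_polys_mult)

lemma uv_polys_single_0: "Poly_Mapping.single 0 c \<in> uv_polys"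
  by (auto simp: uv_polys_def split: if_splits)

lemma uv_polys_var: "var Var_u \<in> uv_polys" "var Var_v \<in> uv_polys"
  by (auto simp: uv_polys_def var_def lookup_single)

lemmas uv_polys_intros = uv_polys_add uv_polys_mult uv_polys_uminus uv_polys_diff uv_polys_sum
  uv_polys_prod uv_polys_power uv_polys_single_0 uv_polys_var

fun special_point :: "bivar \<Rightarrow> 'a::field bipoly" where
  "special_point Var_s = 1"
| "special_point Var_t = 0"
| "special_point Var_u = var Var_u"
| "special_point Var_v = var Var_v"

text \<open>
  The retraction of \<open>K[s,t;u,v]\<close> onto \<open>K[u,v]\<close> given by \<open>s = 1\<close> and \<open>t = 0\<close>.
\<close>

definition specialize :: "'a::field bipoly \<Rightarrow> 'a bipoly" where
  "specialize = eval_along (Poly_Mapping.single 0) special_point"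

lemma specialize_in_uv_polys: "specialize p \<in> uv_polys"
proof -
  have "special_point y \<in> uv_polys" for y
    by (cases y) (simp_all add: uv_polys_var)
  then show ?thesis
    unfolding specialize_def eval_along_def by (intro uv_polys_intros)
qed

lemma specialize_uv_polys:
  assumes "p \<in> uv_polys"
  shows "specialize p = p"
proof -
  have "Poly_Mapping.single 0 c * (\<Prod>y\<in>UNIV. special_point y ^ Poly_Mapping.lookup m y)
      = Poly_Mapping.single m c" if "m \<in> Poly_Mapping.keys p" for m c
  proof -
    have "Poly_Mapping.lookup m Var_s = 0" "Poly_Mapping.lookup m Var_t = 0"
      using assms that by (auto simp: uv_polys_def)
    moreover from this have "Poly_Mapping.single Var_u (Poly_Mapping.lookup m Var_u)
        + Poly_Mapping.single Var_v (Poly_Mapping.lookup m Var_v) = m"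
      by (simp add: uvmon_eq_iff flip: uvmon_def)
    ultimately show ?thesis
      by (simp add: UNIV_bivar var_power mult_single)
  qed
  then have "specialize p = (\<Sum>m\<in>Poly_Mapping.keys p. Poly_Mapping.single m (Poly_Mapping.lookup p m))"
    unfolding specialize_def eval_along_def prod_keys by (intro sum.cong) auto
  then show ?thesis
    by (simp only: sum_singles)
qed

definition uv_ideal :: "'a::field bipoly ^ 3 \<Rightarrow> 'a bipoly set" where
  "uv_ideal h = {(\<Sum>j\<in>UNIV. b $ j * h $ j) | b. \<forall>j. b $ j \<in> uv_polys}"

lemma uv_ideal_add:
  assumes "p \<in> uv_ideal h" "q \<in> uv_ideal h"
  shows "p + q \<in> uv_ideal h"
proof -
  obtain b c where "\<forall>j. b $ j \<in> uv_polys" "p = (\<Sum>j\<in>UNIV. b $ j * h $ j)"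
    "\<forall>j. c $ j \<in> uv_polys" "q = (\<Sum>j\<in>UNIV. c $ j * h $ j)"
    using assms by (auto simp: uv_ideal_def)
  then show ?thesis
    unfolding uv_ideal_def
    by (intro CollectI exI[of _ "b + c"]) (simp add: algebra_simps sum.distrib uv_polys_add)
qed

lemma uv_ideal_mult:
  assumes "r \<in> uv_polys" "p \<in> uv_ideal h"
  shows "r * p \<in> uv_ideal h"
proof -
  obtain b where "\<forall>j. b $ j \<in> uv_polys" "p = (\<Sum>j\<in>UNIV. b $ j * h $ j)"
    using assms(2) by (auto simp: uv_ideal_def)
  then show ?thesis
    unfolding uv_ideal_def using assms(1)
    by (intro CollectI exI[of _ "r *s b"]) (simp add: mult.assoc sum_distrib_left uv_polys_mult)
qed

lemma uv_ideal_base: "h $ k \<in> uv_ideal h"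
proof -
  have "(\<Sum>j\<in>UNIV. axis k 1 $ j * h $ j) = h $ k"
    by (simp add: axis_def if_distrib[of "\<lambda>z. z * _"] cong: if_cong)
  then show ?thesis
    unfolding uv_ideal_def by (intro CollectI exI[of _ "axis k 1"]) (simp add: axis_def)
qed

text \<open>
  Basepoint freeness puts a power of \<open>s u\<close> into the ideal generated by the products
  \<open>g_j h_j\<close>.  Specializing \<open>s = 1\<close>, \<open>t = 0\<close> turns the membership relation into one
  over \<open>K[u,v]\<close> in which the \<open>g_j\<close> are absorbed by the coefficients.  This replaces an appeal to
  the Nullstellensatz for the \<open>h_j\<close>.
\<close>

lemma var_power_in_uv_ideal:
  fixes g h :: "'a::field bipoly ^ 3"
  assumes bpf: "basepoint_free (kvs.span (range (($) (products g h))))"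
    and h: "\<And>j. h $ j \<in> uv_polys" and y: "y \<in> {Var_u, Var_v}"
  obtains N where "var y ^ N \<in> uv_ideal h"
proof -
  obtain N where "(var Var_s * var y) ^ N \<in> base_ideal (kvs.span (range (($) (products g h))))"
    using basepoint_free_power[OF bpf, of Var_s y] y by auto
  then have "(var Var_s * var y) ^ N \<in> ideal_gen (range (($) (products g h)))"
    by (simp only: base_ideal_span)
  then have "specialize ((var Var_s * var y) ^ N) \<in> uv_ideal h"
  proof (induction rule: ideal_gen_induct)
    case zero
    show ?case
      using uv_ideal_mult[OF uv_polys_zero uv_ideal_base] by (simp add: specialize_def)
  next
    case (add p q)
    then show ?case
      using uv_ideal_add by (simp add: specialize_def const.eval_add)
  next
    case (mult r p)
    then show ?case
      using uv_ideal_mult[OF specialize_in_uv_polys[of r]] by (simp add: specialize_def const.eval_mult)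
  next
    case (base p)
    then obtain k where "p = g $ k * h $ k"
      by (auto simp: products_def)
    then have "specialize p = specialize (g $ k) * h $ k"
      using specialize_uv_polys[OF h] by (simp add: specialize_def const.eval_mult)
    then show ?case
      using uv_ideal_mult[OF specialize_in_uv_polys uv_ideal_base] by simp
  qed
  moreover have "specialize ((var Var_s * var y) ^ N) = var y ^ N"
    using y by (auto simp: specialize_def const.eval_power const.eval_mult const.eval_var)
  ultimately show ?thesis
    using that by metis
qed

section \<open>Binary forms and univariate polynomials\<close>

text \<open>
  The monomials of a binary form of degree \<open>d\<close>, listed by the exponent of \<open>u\<close>.
\<close>

lemma uv_forms_iff:
  "p \<in> uv_forms d \<longleftrightarrow> (\<forall>m\<in>Poly_Mapping.keys p. \<exists>k\<le>d. m = uvmon k (d - k))"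
proof -
  have "Poly_Mapping.lookup m Var_s = 0 \<and> Poly_Mapping.lookup m Var_t = 0 \<and> bidegree m = (0, d)
      \<longleftrightarrow> (\<exists>k\<le>d. m = uvmon k (d - k))" for m
  proof
    assume "Poly_Mapping.lookup m Var_s = 0 \<and> Poly_Mapping.lookup m Var_t = 0 \<and> bidegree m = (0, d)"
    then show "\<exists>k\<le>d. m = uvmon k (d - k)"
      by (intro exI[of _ "Poly_Mapping.lookup m Var_u"])
         (auto simp: bidegree_def intro!: uvmon_eq_iff[THEN iffD2, symmetric])
  qed (auto simp: bidegree_def)
  then show ?thesis
    unfolding uv_forms_def uv_polys_def bihom_def by blast
qed

text \<open>
  The affine coordinate is \<open>u\<close>, so \<open>x^k\<close> corresponds to \<open>u^k v^(e - k)\<close>.  The degree \<open>e\<close> of the form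
  is a parameter: it may exceed the degree of \<open>p\<close>, and then the form is divisible by \<open>v\<close>.
\<close>

definition homogenize :: "nat \<Rightarrow> 'a::field poly \<Rightarrow> 'a bipoly" where
  "homogenize e p = (\<Sum>k\<le>e. Poly_Mapping.single (uvmon k (e - k)) (coeff p k))"

definition dehomogenize :: "nat \<Rightarrow> 'a::field bipoly \<Rightarrow> 'a poly" where
  "dehomogenize d p = (\<Sum>k\<le>d. monom (Poly_Mapping.lookup p (uvmon k (d - k))) k)"

lemma coeff_dehomogenize:
  "coeff (dehomogenize d p) k = (if k \<le> d then Poly_Mapping.lookup p (uvmon k (d - k)) else 0)"
  by (simp add: dehomogenize_def coeff_sum)

lemma degree_dehomogenize: "degree (dehomogenize d p) \<le> d"
  by (rule degree_le) (simp add: coeff_dehomogenize)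

lemma homogenize_in_uv_forms: "homogenize e p \<in> uv_forms e"
  unfolding uv_forms_iff
proof
  fix m assume m: "m \<in> Poly_Mapping.keys (homogenize e p)"
  show "\<exists>k\<le>e. m = uvmon k (e - k)"
  proof (rule ccontr)
    assume "\<not> (\<exists>k\<le>e. m = uvmon k (e - k))"
    then have "Poly_Mapping.lookup (homogenize e p) m = 0"
      by (auto simp: homogenize_def lookup_sum lookup_single when_def intro!: sum.neutral)
    with m show False by (simp add: in_keys_iff)
  qed
qed

lemma lookup_homogenize:
  assumes "k \<le> e"
  shows "Poly_Mapping.lookup (homogenize e p) (uvmon k (e - k)) = coeff p k"
proof -
  have "uvmon k' (e - k') = uvmon k (e - k) \<longleftrightarrow> k' = k" for k'
    by (auto simp: uvmon_eq_iff)
  then show ?thesis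
    using assms by (simp add: homogenize_def lookup_sum lookup_single when_def)
qed

lemma homogenize_dehomogenize:
  fixes p :: "'a::field bipoly"
  assumes "p \<in> uv_forms d"
  shows "homogenize d (dehomogenize d p) = p"
proof (rule poly_mapping_eqI)
  fix m
  show "Poly_Mapping.lookup (homogenize d (dehomogenize d p)) m = Poly_Mapping.lookup p m"
  proof (cases "\<exists>k\<le>d. m = uvmon k (d - k)")
    case True
    then show ?thesis
      by (auto simp: lookup_homogenize coeff_dehomogenize)
  next
    case False
    then have "m \<notin> Poly_Mapping.keys q" if "q \<in> uv_forms d" for q :: "'a bipoly"
      using that by (auto simp: uv_forms_iff)
    from this[OF assms] this[OF homogenize_in_uv_forms] show ?thesis
      by (simp add: in_keys_iff)
  qed
qed

lemma homogenize_add: "homogenize e (p + q) = homogenize e p + homogenize e q"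
  by (simp add: homogenize_def single_add sum.distrib)

lemma homogenize_diff: "homogenize e (p - q) = homogenize e p - homogenize e q"
  by (simp add: homogenize_def single_diff sum_subtractf)

lemma homogenize_sum: "homogenize e (\<Sum>i\<in>A. f i) = (\<Sum>i\<in>A. homogenize e (f i))"
proof (induction A rule: infinite_finite_induct)
  case (insert x F)
  then show ?case by (simp add: homogenize_add)
qed (simp_all add: homogenize_def)

lemma homogenize_monom:
  assumes "k \<le> e"
  shows "homogenize e (monom c k) = Poly_Mapping.single (uvmon k (e - k)) c"
proof -
  have "homogenize e (monom c k) = (\<Sum>j\<le>e. if j = k then Poly_Mapping.single (uvmon k (e - k)) c else 0)"
    unfolding homogenize_def by (intro sum.cong) auto
  with assms show ?thesis by simp
qed

lemma homogenize_mult: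
  assumes "degree p \<le> e" "degree q \<le> f"
  shows "homogenize (e + f) (p * q) = homogenize e p * homogenize f q"
proof -
  have p: "(\<Sum>k\<le>e. monom (coeff p k) k) = p" and q: "(\<Sum>k\<le>f. monom (coeff q k) k) = q"
    by (simp_all add: poly_as_sum_of_monoms' assms)
  have "homogenize (e + f) (p * q)
      = homogenize (e + f) ((\<Sum>k\<le>e. monom (coeff p k) k) * (\<Sum>l\<le>f. monom (coeff q l) l))"
    by (simp only: p q)
  also have "\<dots> = (\<Sum>k\<le>e. \<Sum>l\<le>f. homogenize (e + f) (monom (coeff p k * coeff q l) (k + l)))"
    by (simp only: sum_product homogenize_sum mult_monom)
  also have "\<dots> = (\<Sum>k\<le>e. \<Sum>l\<le>f. Poly_Mapping.single (uvmon k (e - k)) (coeff p k)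
                                * Poly_Mapping.single (uvmon l (f - l)) (coeff q l))"
    by (intro sum.cong refl) (simp add: homogenize_monom mult_single uvmon_add)
  also have "\<dots> = homogenize e p * homogenize f q"
    by (simp only: homogenize_def sum_product)
  finally show ?thesis .
qed

lemma cross_homogenize:
  fixes p q :: "'a::field poly ^ 3"
  assumes "\<And>j. degree (p $ j) \<le> e" "\<And>j. degree (q $ j) \<le> f"
  shows "cross (\<chi> j. homogenize e (p $ j)) (\<chi> j. homogenize f (q $ j))
           = (\<chi> j. homogenize (e + f) (cross p q $ j))"
  using assms by (simp add: vec3_eq_iff homogenize_diff homogenize_mult)

section \<open>Hilbert-Burch matrices\<close>

text \<open>
  Coprimality of \<open>u\<close> and \<open>v\<close>, read off from monomials: multiplication by a power of \<open>v\<close> leaves the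
  exponents of \<open>u\<close> unchanged, so each monomial of \<open>B\<close> is divisible by \<open>u^N\<close>.
\<close>

lemma u_power_dvd:
  fixes B C :: "'a::field bipoly"
  assumes eq: "var Var_v ^ N' * B = var Var_u ^ N * C" and B: "B \<in> uv_polys"
  obtains k where "k \<in> uv_polys" "B = var Var_u ^ N * k"
proof -
  let ?u = "Poly_Mapping.single Var_u N" and ?v = "Poly_Mapping.single Var_v N'"
  (* The truncated subtraction of exponents is exact on the monomials of B, as shown next. *)
  define k where "k = (\<Sum>m\<in>Poly_Mapping.keys B. Poly_Mapping.single (m - ?u) (Poly_Mapping.lookup B m))"
  have u_le: "?u + (m - ?u) = m" if m: "m \<in> Poly_Mapping.keys B" for m
  proof -
    have "?v + m \<in> Poly_Mapping.keys (var Var_v ^ N' * B)"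
      using m by (simp add: var_power in_keys_iff lookup_single_mult)
    then have "?v + m \<in> Poly_Mapping.keys (Poly_Mapping.single ?u 1 * C)"
      by (simp only: eq[unfolded var_power] var_power)
    then obtain b where b: "?v + m = ?u + b"
      using keys_mult[of "Poly_Mapping.single ?u 1" C] by auto
    have "N \<le> Poly_Mapping.lookup m Var_u"
      using arg_cong[OF b, of "\<lambda>m. Poly_Mapping.lookup m Var_u"] by (simp add: lookup_add lookup_single)
    then show ?thesis
      by (intro poly_mapping_eqI) (auto simp: lookup_add lookup_minus lookup_single when_def)
  qed
  have "var Var_u ^ N * k = (\<Sum>m\<in>Poly_Mapping.keys B. Poly_Mapping.single (?u + (m - ?u)) (Poly_Mapping.lookup B m))"
    by (simp add: k_def var_power sum_distrib_left mult_single)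
  also have "\<dots> = (\<Sum>m\<in>Poly_Mapping.keys B. Poly_Mapping.single m (Poly_Mapping.lookup B m))"
    by (intro sum.cong refl) (simp only: u_le)
  finally have "B = var Var_u ^ N * k"
    by (simp only: sum_singles)
  moreover have "k \<in> uv_polys"
    unfolding k_def
    using B by (intro uv_polys_sum) (auto simp: uv_polys_def lookup_minus split: if_splits)
  ultimately show ?thesis
    using that by blast
qed

text \<open>
  If \<open>r = \<Sum>i. b_i h_i\<close>, then \<open>r w_j = \<Sum>i. b_i w_i h_j\<close> by proportionality, so \<open>r w\<close> is a multiple
  of \<open>h\<close>.  For \<open>r = u^N\<close> and \<open>r = v^N'\<close> this says \<open>u^N w = B h\<close> and \<open>v^N' w = C h\<close>; hence
  \<open>v^N' B = u^N C\<close>, and \<open>u^N\<close> can be divided out of \<open>B\<close>.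
\<close>

lemma proportional_imp_multiple:
  fixes h w :: "'a::field bipoly ^ 3"
  assumes u: "var Var_u ^ N \<in> uv_ideal h" and v: "var Var_v ^ N' \<in> uv_ideal h"
    and w_uv: "\<And>j. w $ j \<in> uv_polys"
    and proportional: "\<And>i j. h $ i * w $ j = h $ j * w $ i"
  obtains k where "k \<in> uv_polys" "w = k *s h"
proof -
  obtain b where b: "\<And>j. b $ j \<in> uv_polys" "var Var_u ^ N = (\<Sum>j\<in>UNIV. b $ j * h $ j)"
    using u by (auto simp: uv_ideal_def)
  obtain c where c: "\<And>j. c $ j \<in> uv_polys" "var Var_v ^ N' = (\<Sum>j\<in>UNIV. c $ j * h $ j)"
    using v by (auto simp: uv_ideal_def)
  define B where "B = (\<Sum>i\<in>UNIV. b $ i * w $ i)"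
  define C where "C = (\<Sum>i\<in>UNIV. c $ i * w $ i)"
  have combine: "(\<Sum>i\<in>UNIV. r $ i * h $ i) * w $ j = (\<Sum>i\<in>UNIV. r $ i * w $ i) * h $ j" for r j
    unfolding sum_distrib_right
  proof (rule sum.cong)
    show "r $ i * h $ i * w $ j = r $ i * w $ i * h $ j" for i
      using proportional[of i j] by (simp add: mult.assoc mult.commute)
  qed simp
  have B: "var Var_u ^ N * w $ j = B * h $ j" and C: "var Var_v ^ N' * w $ j = C * h $ j" for j
    by (simp_all only: B_def C_def b(2) c(2) combine)
  have u0: "(var Var_u :: 'a bipoly) ^ N \<noteq> 0"
    by (rule var_power_neq_0)
  then have "h \<noteq> 0"
    using b(2) by auto
  then obtain j where j: "h $ j \<noteq> 0"
    by (rule vec3_neq_0)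
  have "(var Var_v ^ N' * B) * h $ j = (var Var_u ^ N * C) * h $ j"
  proof -
    have "(var Var_v ^ N' * B) * h $ j = var Var_v ^ N' * (var Var_u ^ N * w $ j)"
      by (simp only: B mult.assoc)
    also have "\<dots> = var Var_u ^ N * (var Var_v ^ N' * w $ j)"
      by (rule mult.left_commute)
    also have "\<dots> = (var Var_u ^ N * C) * h $ j"
      by (simp only: C mult.assoc)
    finally show ?thesis .
  qed
  with j have "var Var_v ^ N' * B = var Var_u ^ N * C"
    by simp
  moreover have "B \<in> uv_polys"
    unfolding B_def by (intro uv_polys_sum uv_polys_mult b(1) w_uv)
  ultimately obtain k where k: "k \<in> uv_polys" "B = var Var_u ^ N * k"
    by (rule u_power_dvd)
  have "w $ j = k * h $ j" for j
  proof -
    have "var Var_u ^ N * w $ j = var Var_u ^ N * (k * h $ j)"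
      by (simp only: B k(2) mult.assoc)
    then show ?thesis
      by (rule mult_left_cancel[OF u0, THEN iffD1])
  qed
  then have "w = k *s h"
    by (simp add: vec_eq_iff)
  with k(1) show ?thesis
    by (rule that)
qed

text \<open>
  The top coefficient of the dehomogenized \<open>h_j\<close> is the value of \<open>h_j\<close> at \<open>(u, v) = (1, 0)\<close>, a point
  where every element of the ideal of the \<open>h_j\<close> would vanish if all \<open>h_j\<close> did, whereas \<open>u^N\<close> has the value 1.
\<close>

lemma top_coefficient_neq_0:
  assumes h: "\<And>j. h $ j \<in> uv_forms d" and u: "var Var_u ^ N \<in> uv_ideal h"
  obtains j where "coeff (dehomogenize d (h $ j)) d \<noteq> 0"
proof (rule ccontr)
  assume *: "\<not> thesis"
  define x where "x = (\<lambda>y. if y = Var_u then 1 else (0 :: 'a bipoly))"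
  have "eval_along (Poly_Mapping.single 0) x (h $ j) = 0" for j
    unfolding eval_along_def prod_keys
  proof (rule sum.neutral, rule ballI)
    fix m assume m: "m \<in> Poly_Mapping.keys (h $ j)"
    then obtain k where k: "k \<le> d" "m = uvmon k (d - k)"
      using h[of j] by (auto simp: uv_forms_iff)
    moreover have "coeff (dehomogenize d (h $ j)) d = 0"
      using * that by blast
    ultimately have "k \<noteq> d"
      using m by (auto simp: coeff_dehomogenize in_keys_iff)
    with k have "(\<Prod>y\<in>UNIV. x y ^ Poly_Mapping.lookup m y) = 0"
      by (intro prod_zero bexI[of _ Var_v]) (auto simp: x_def)
    then show "Poly_Mapping.single 0 (Poly_Mapping.lookup (h $ j) m) * (\<Prod>y\<in>UNIV. x y ^ Poly_Mapping.lookup m y) = 0"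
      by simp
  qed
  then have "eval_along (Poly_Mapping.single 0) x (var Var_u ^ N) = 0"
    using u by (auto simp: uv_ideal_def const.eval_sum const.eval_mult)
  then show False
    by (simp add: const.eval_power const.eval_var x_def)
qed

lemma UNIV_2_from_0: "(UNIV :: 2 set) = {0, 1}"
  by (rule sym, rule card_subset_eq) auto

lemma exhaust_2_from_0: "k = 1 \<or> k = (0 :: 2)"
  using UNIV_2_from_0 by blast

lemma uv_column_span_UNIV:
  "uv_column_span M UNIV
     = {\<alpha> *s column 1 M + \<beta> *s column 0 M | \<alpha> \<beta>. \<alpha> \<in> uv_polys \<and> \<beta> \<in> uv_polys}"
  (is "_ = ?R")
proof (intro equalityI subsetI)
  have sum: "(\<Sum>k\<in>UNIV. p k *s column k M) = p 1 *s column 1 M + p 0 *s column 0 M" for p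
    by (simp add: UNIV_2_from_0 add.commute)
  fix a
  show "a \<in> ?R" if "a \<in> uv_column_span M UNIV"
    using that unfolding uv_column_span_def sum by blast
  assume "a \<in> ?R"
  then obtain \<alpha> \<beta> where "a = \<alpha> *s column 1 M + \<beta> *s column 0 M" "\<alpha> \<in> uv_polys" "\<beta> \<in> uv_polys"
    by blast
  then have "a = (\<Sum>k\<in>UNIV. (if k = 1 then \<alpha> else \<beta>) *s column k M)
      \<and> (\<forall>k :: 2. (if k = 1 then \<alpha> else \<beta>) \<in> uv_polys)"
    by (simp add: sum)
  then show "a \<in> uv_column_span M UNIV"
    unfolding uv_column_span_def by (intro CollectI exI[of _ "\<lambda>k. if k = 1 then \<alpha> else \<beta>"])
qed

text \<open>
  For a syzygy \<open>a\<close>, the cross products of \<open>a\<close> with the columns are multiples of \<open>h\<close>, so Cramer's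
  rule writes \<open>a\<close> as a combination of the columns with coefficients in \<open>K[u,v]\<close>.  Minimality holds
  because the columns, having a nonzero cross product, are not both multiples of one vector.
\<close>

lemma hilbert_burch_matrix_if_cross:
  fixes h :: "'a::field bipoly ^ 3" and M :: "'a bipoly ^ 2 ^ 3"
  assumes u: "var Var_u ^ N \<in> uv_ideal h" and v: "var Var_v ^ N' \<in> uv_ideal h"
    and "h \<noteq> 0" and cross: "cross (column 1 M) (column 0 M) = h"
    and deg: "column_of_degree M 1 e" "column_of_degree M 0 f"
  shows "hilbert_burch_matrix h M"
proof -
  have uv: "column k M $ j \<in> uv_polys" for k j
    using deg exhaust_2_from_0[of k] by (auto simp: column_of_degree_def uv_forms_def)
  have syz: "syzygy h (column k M)" for k
    using syzygy_cross[of "column 1 M" "column 0 M"] exhaust_2_from_0[of k] by (auto simp: cross)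
  have multiple: "\<exists>c\<in>uv_polys. cross a b = c *s h"
    if "a \<in> uv_syzygies h" "b \<in> uv_syzygies h" for a b
  proof -
    have "cross a b $ j \<in> uv_polys" for j
      using that exhaust_3[of j]
      by (elim disjE) (auto simp: uv_syzygies_def intro!: uv_polys_intros)
    moreover have "h $ i * cross a b $ j = h $ j * cross a b $ i" for i j
      using that by (intro cross_syzygies_proportional) (simp_all add: uv_syzygies_def)
    ultimately obtain c where "c \<in> uv_polys" "cross a b = c *s h"
      using proportional_imp_multiple[OF u v, of "cross a b"] by metis
    then show ?thesis by blast
  qed
  have col: "column k M \<in> uv_syzygies h" for k
    using uv syz by (simp add: uv_syzygies_def)
  have "uv_column_span M UNIV = uv_syzygies h"
    unfolding uv_column_span_UNIV
  proof (intro equalityI subsetI)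
    fix a assume "a \<in> {\<alpha> *s column 1 M + \<beta> *s column 0 M | \<alpha> \<beta>. \<alpha> \<in> uv_polys \<and> \<beta> \<in> uv_polys}"
    then show "a \<in> uv_syzygies h"
      using uv syz by (auto simp: uv_syzygies_def intro!: uv_polys_intros syzygy_add syzygy_scale)
  next
    fix a assume a: "a \<in> uv_syzygies h"
    obtain \<alpha> \<beta> where *: "\<alpha> \<in> uv_polys" "cross a (column 0 M) = \<alpha> *s h"
      "\<beta> \<in> uv_polys" "cross (column 1 M) a = \<beta> *s h"
      using multiple[OF a col] multiple[OF col a] by blast
    have "syzygy h a"
      using a by (simp add: uv_syzygies_def)
    from syzygy_combination[OF \<open>h \<noteq> 0\<close> cross this *(2,4)]
    show "a \<in> {\<alpha> *s column 1 M + \<beta> *s column 0 M | \<alpha> \<beta>. \<alpha> \<in> uv_polys \<and> \<beta> \<in> uv_polys}"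
      using *(1,3) by blast
  qed
  moreover have "uv_column_span M J \<noteq> uv_syzygies h" if J: "J \<subset> UNIV" for J
  proof
    assume *: "uv_column_span M J = uv_syzygies h"
    obtain k where "J \<subseteq> {k}"
      using J unfolding UNIV_2_from_0 by blast
    have "\<exists>r. x = r *s column k M" if "x \<in> uv_column_span M J" for x
    proof -
      have "J = {} \<or> J = {k}"
        using \<open>J \<subseteq> {k}\<close> by blast
      then show ?thesis
        using that by (auto simp: uv_column_span_def intro: exI[of _ 0])
    qed
    then obtain r r' where "column 1 M = r *s column k M" "column 0 M = r' *s column k M"
      using col unfolding * by metis
    then have "h = 0"
      using cross cross_parallel by metis
    with \<open>h \<noteq> 0\<close> show False ..
  qed
  moreover have "\<exists>d. column_of_degree M k d" for k
    using deg exhaust_2_from_0[of k] by auto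
  ultimately show ?thesis
    by (simp add: hilbert_burch_matrix_def)
qed

text \<open>
  Homogenization commutes with products, so the univariate pair becomes a pair of vectors of forms
  with cross product \<open>h\<close>.  This needs the univariate degrees to add up to exactly \<open>d\<close>, which is why
  some \<open>h_j\<close> has to have a nonzero top coefficient.
\<close>

theorem hilbert_burch_exists:
  fixes h :: "'a::field bipoly ^ 3"
  assumes h: "\<And>j. h $ j \<in> uv_forms d"
    and u: "var Var_u ^ N \<in> uv_ideal h" and v: "var Var_v ^ N' \<in> uv_ideal h"
  obtains M \<mu> where "hilbert_burch_matrix h M" "\<mu> \<le> d"
    "column_of_degree M 0 (d - \<mu>)" "column_of_degree M 1 \<mu>" "\<And>k. syzygy h (column k M)" "\<And>k. column k M \<noteq> 0"
proof -
  let ?h = "\<chi> j. dehomogenize d (h $ j)"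
  have bound: "degree (?h $ j) \<le> d" for j
    by (simp add: degree_dehomogenize)
  obtain j0 where top: "coeff (?h $ j0) d \<noteq> 0"
    using top_coefficient_neq_0[OF h u] by auto
  obtain p q \<mu> f where pq: "cross p q = ?h" "\<mu> + f = d"
    and deg: "\<forall>j. degree (p $ j) \<le> \<mu>" "\<forall>j. degree (q $ j) \<le> f"
    by (rule mu_basis_poly[OF bound top])
  define M :: "'a bipoly ^ 2 ^ 3"
    where "M = (\<chi> j k. if k = 0 then homogenize f (q $ j) else homogenize \<mu> (p $ j))"
  have M: "column 0 M = (\<chi> j. homogenize f (q $ j))" "column 1 M = (\<chi> j. homogenize \<mu> (p $ j))"
    by (simp_all add: M_def column_def vec_eq_iff)
  have cross: "cross (column 1 M) (column 0 M) = h"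
    using h by (simp add: M cross_homogenize[OF deg[rule_format]] pq homogenize_dehomogenize vec_eq_iff)
  have cols: "column_of_degree M 1 \<mu>" "column_of_degree M 0 f"
    by (simp_all add: column_of_degree_def M homogenize_in_uv_forms)
  have "(var Var_u :: 'a bipoly) ^ N \<noteq> 0"
    by (rule var_power_neq_0)
  then have "h \<noteq> 0"
    using u by (auto simp: uv_ideal_def)
  have "column 1 M \<noteq> 0" "column 0 M \<noteq> 0"
    using cross \<open>h \<noteq> 0\<close> by (auto simp: vec3_eq_iff)
  then have "column k M \<noteq> 0" for k
    using exhaust_2_from_0[of k] by auto
  moreover have "syzygy h (column k M)" for k
    using syzygy_cross[of "column 1 M" "column 0 M"] exhaust_2_from_0[of k] by (auto simp: cross)
  ultimately show ?thesis
    using that[of M \<mu>] hilbert_burch_matrix_if_cross[OF u v \<open>h \<noteq> 0\<close> cross cols] cols pq(2) by auto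
qed

section \<open>Lifting syzygies\<close>

lemma bihom_mult: "p \<in> bihom e \<Longrightarrow> q \<in> bihom f \<Longrightarrow> p * q \<in> bihom (e + f)"
  using keys_mult[of p q] by (fastforce simp: bihom_def bidegree_def lookup_add)

lemma bihom_prod:
  assumes "\<And>k. k \<in> A \<Longrightarrow> g k \<in> bihom (a, b)"
  shows "prod g A \<in> bihom (card A * a, card A * b)"
  using assms
proof (induction A rule: infinite_finite_induct)
  case (insert x F)
  then show ?case
    using bihom_mult[of "g x" "(a, b)" "prod g F" "(card F * a, card F * b)"] by simp
qed (auto simp: bihom_def bidegree_def)

text \<open>
  Each summand of the lifted relation is the corresponding summand of the given one, multiplied by
  the product of all three \<open>g_k\<close>.
\<close>

lemma syzygy_lift: "syzygy h a \<Longrightarrow> syzygy (products g h) (lift_syzygy g a)"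
proof -
  assume a: "syzygy h a"
  have "lift_syzygy g a $ j * products g h $ j = (\<Prod>k\<in>UNIV. g $ k) * (a $ j * h $ j)" for j
    using prod.remove[of UNIV j "\<lambda>k. g $ k"]
    by (simp add: lift_syzygy_def products_def mult_ac)
  then show ?thesis
    using a by (simp add: syzygy_def flip: sum_distrib_left)
qed

lemma products_commute: "products g h = products h g"
  by (simp add: products_def mult.commute)

lemma lift_syzygy_neq_0:
  fixes g a :: "'r::idom ^ 3"
  assumes "\<And>j. g $ j \<noteq> 0" "a \<noteq> 0"
  shows "lift_syzygy g a \<noteq> 0"
proof -
  obtain j where "a $ j \<noteq> 0"
    using assms(2) by (rule vec3_neq_0)
  then have "lift_syzygy g a $ j \<noteq> 0"
    using assms(1) by (simp add: lift_syzygy_def)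
  then show ?thesis by auto
qed

lemma lift_syzygy_bidegree:
  assumes g: "\<And>j. g $ j \<in> bihom (1, i)" "\<And>j. g $ j \<noteq> 0"
    and a: "syzygy h a" "a \<noteq> 0" "\<And>j. a $ j \<in> bihom (0, e)"
  shows "syzygy_of_bidegree n (products g h) (lift_syzygy g a) (3, n + 2 * i + e)"
proof -
  have "lift_syzygy g a $ j \<in> bihom (2, 2 * i + e)" for j
  proof -
    have "card (UNIV - {j} :: 3 set) = 2"
      by (simp add: card_Diff_singleton)
    then have "(\<Prod>k\<in>UNIV - {j}. g $ k) \<in> bihom (2, 2 * i)"
      using bihom_prod[of "UNIV - {j}" "\<lambda>k. g $ k" 1 i] g(1) by simp
    from bihom_mult[OF this a(3)[of j]] show ?thesis
      by (simp add: lift_syzygy_def)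
  qed
  then show ?thesis
    using syzygy_lift[OF a(1), of g] lift_syzygy_neq_0[of g a] g(2) a(2)
    by (auto simp: syzygy_of_bidegree_def intro!: exI[of _ "(2, 2 * i + e)"])
qed

text \<open>
  The span only sees the set of the \<open>h_j\<close>.  It has dimension three if the \<open>h_j\<close> are distinct and
  linearly independent; otherwise the relation is \<open>h_j - h_k = 0\<close> for two equal entries, or a linear
  dependence of the set.
\<close>

lemma constant_relation:
  fixes h :: "'a::field bipoly ^ 3"
  assumes "kvs.dim (kvs.span (range (($) h))) \<noteq> 3"
  obtains c where "c \<noteq> 0" "syzygy h (\<chi> j. Poly_Mapping.single 0 (c $ j))"
proof (cases "inj (($) h)")
  case False
  then obtain j k where jk: "j \<noteq> k" "h $ j = h $ k"
    by (auto simp: inj_def)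
  define c :: "'a ^ 3" where "c = axis j 1 - axis k 1"
  have "(\<Sum>l\<in>UNIV. Poly_Mapping.single 0 (c $ l) * h $ l)
      = (\<Sum>l\<in>UNIV. (if l = j then h $ l else 0) - (if l = k then h $ l else 0))"
    using jk(1) by (intro sum.cong) (auto simp: c_def axis_def single_uminus)
  then have "syzygy h (\<chi> j. Poly_Mapping.single 0 (c $ j))"
    using jk by (simp add: syzygy_def sum_subtractf)
  moreover have "c \<noteq> 0"
    using jk(1) by (auto simp: c_def axis_def vec_eq_iff)
  ultimately show ?thesis
    using that by blast
next
  case True
  then have card: "card (range (($) h)) = 3"
    by (simp add: card_image)
  have "kvs.dependent (range (($) h))"
    using assms card kvs.dim_eq_card_independent[of "range (($) h)"] by (auto simp: kvs.dim_span)
  then obtain u where u: "\<exists>v\<in>range (($) h). u v \<noteq> 0" "(\<Sum>v\<in>range (($) h). kscale (u v) v) = 0"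
    by (auto simp: kvs.dependent_finite)
  have "(\<Sum>j\<in>UNIV. kscale (u (h $ j)) (h $ j)) = 0"
    using u(2) by (simp add: sum.reindex True)
  then have "syzygy h (\<chi> j. Poly_Mapping.single 0 ((\<chi> j. u (h $ j)) $ j))"
    by (simp add: syzygy_def kscale_def)
  moreover have "(\<chi> j. u (h $ j)) \<noteq> 0"
    using u(1) by (auto simp: vec_eq_iff)
  ultimately show ?thesis
    using that by blast
qed

text \<open>
  A common zero of the \<open>f_j\<close> would be a zero of every element of their ideal, in particular of a
  power of the product of two coordinates that are nonzero at the point.
\<close>

lemma basepoint_free_no_common_zero:
  fixes f :: "'a::field bipoly ^ 3"
  assumes bpf: "basepoint_free (kvs.span (range (($) f)))" and "P \<noteq> (0, 0)" "Q \<noteq> (0, 0)"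
  obtains j where "eval_ac (point P Q) (f $ j) \<noteq> 0"
proof (rule ccontr)
  assume "\<not> thesis"
  with that have zero: "eval_ac (point P Q) (f $ j) = 0" for j
    by blast
  obtain x where x: "x \<in> {Var_s, Var_t}" "point P Q x \<noteq> 0"
    using assms(2) by (cases P; cases Q) force
  obtain y where y: "y \<in> {Var_u, Var_v}" "point P Q y \<noteq> 0"
    using assms(3) by (cases P; cases Q) force
  obtain N where "(var x * var y) ^ N \<in> base_ideal (kvs.span (range (($) f)))"
    using basepoint_free_power[OF bpf x(1) y(1)] .
  then have "(var x * var y) ^ N \<in> ideal_gen (range (($) f))"
    by (simp only: base_ideal_span)
  then have "eval_along to_ac (point P Q) ((var x * var y) ^ N) = 0"
    by (rule to_ac.eval_ideal_gen_eq_0) (use zero in \<open>auto simp: eval_ac_eq_eval_along\<close>)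
  then show False
    using x(2) y(2) by (simp add: to_ac.eval_power to_ac.eval_mult to_ac.eval_var)
qed

lemma eval_ac_uv_polys:
  assumes "p \<in> uv_polys"
  shows "eval_ac (point P Q) p = eval_ac (point P' Q) p"
proof -
  have "point P Q y ^ Poly_Mapping.lookup m y = point P' Q y ^ Poly_Mapping.lookup m y"
    if "m \<in> Poly_Mapping.keys p" for m y
    using assms that by (cases P; cases P'; cases Q; cases y) (auto simp: uv_polys_def)
  then show ?thesis
    by (simp add: eval_ac_def)
qed

theorem theorem5p1:
  fixes n i :: nat
    and W :: "'a::field bipoly set"
    and g h :: "'a bipoly ^ 3"
  assumes n: "n \<ge> 3"
    and i: "i \<le> n - 1"
    and W_subspace: "kvs.subspace W"
    and W_bidegree: "W \<subseteq> bihom (1, n)"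
    and W_dim: "kvs.dim W = 3"
    and W_bpf: "basepoint_free W"
    and g: "\<And>j. g $ j \<in> bihom (1, i)"
    and h: "\<And>j. h $ j \<in> uv_forms (n - i)"
    and basis_indep: "kvs.independent (range (($) (products g h)))"
    and basis_span: "kvs.span (range (($) (products g h))) = W"
  shows "(bpf_sections_P1 h \<and> bpf_sections_P1xP1 g) \<and>
    ((\<forall>a. syzygy h a \<longrightarrow> syzygy (products g h) (lift_syzygy g a)) \<and>
     (\<forall>c. syzygy g c \<longrightarrow> syzygy (products g h) (lift_syzygy h c))) \<and>
    (pencil h \<longrightarrow> (\<exists>a. syzygy_of_bidegree n (products g h) a (3, 2 * i + n))) \<and>
    (\<not> pencil h \<longrightarrow>
       (\<exists>M \<mu>. hilbert_burch_matrix h M \<and> \<mu> \<le> n - i \<and>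
          column_of_degree M 0 (n - i - \<mu>) \<and> column_of_degree M 1 \<mu> \<and>
          syzygy_of_bidegree n (products g h) (lift_syzygy g (column 1 M)) (3, n + 2 * i + \<mu>) \<and>
          syzygy_of_bidegree n (products g h) (lift_syzygy g (column 0 M)) (3, 2 * n + i - \<mu>)))"
proof -
  have bpf: "basepoint_free (kvs.span (range (($) (products g h))))"
    using W_bpf by (simp only: basis_span)
  have h_uv: "h $ j \<in> uv_polys" for j
    using h by (simp add: uv_forms_def)
  have g_nonzero: "g $ j \<noteq> 0" for j
  proof
    assume "g $ j = 0"
    then have "0 \<in> range (($) (products g h))"
      by (auto simp: products_def intro: image_eqI[of _ _ j])
    with basis_indep show False
      using kvs.dependent_zero by blast
  qed
  have product_zero: "\<exists>j. eval_ac (point P Q) (g $ j) \<noteq> 0 \<and> eval_ac (point P Q) (h $ j) \<noteq> 0"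
    if "P \<noteq> (0, 0)" "Q \<noteq> (0, 0)" for P Q
    using basepoint_free_no_common_zero[OF bpf that]
    by (auto simp: products_def eval_ac_eq_eval_along to_ac.eval_mult)
  have "bpf_sections_P1xP1 g"
    unfolding bpf_sections_P1xP1_def using product_zero by blast
  moreover have "bpf_sections_P1 h"
    unfolding bpf_sections_P1_def
  proof (intro allI impI)
    fix Q :: "'a alg_closure \<times> 'a alg_closure" assume "Q \<noteq> (0, 0)"
    (* The coordinates (0, 0) are not a point of the projective line; (1, 0) gives the same value,
       since the h_j involve only u and v. *)
    then obtain j where "eval_ac (point (1, 0) Q) (h $ j) \<noteq> 0"
      using product_zero[of "(1, 0)" Q] by auto
    then show "\<exists>j. eval_ac (point (0, 0) Q) (h $ j) \<noteq> 0"
      using eval_ac_uv_polys[OF h_uv] by metis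
  qed
  moreover have "\<exists>a. syzygy_of_bidegree n (products g h) a (3, 2 * i + n)" if "pencil h"
  proof -
    obtain c where c: "c \<noteq> 0" "syzygy h (\<chi> j. Poly_Mapping.single 0 (c $ j))"
      using \<open>pencil h\<close> constant_relation[of h] by (auto simp: pencil_def)
    have "(\<chi> j. Poly_Mapping.single 0 (c $ j)) \<noteq> (0 :: 'a bipoly ^ 3)"
    proof -
      obtain j where "c $ j \<noteq> 0"
        using c(1) by (rule vec3_neq_0)
      then have "Poly_Mapping.lookup (Poly_Mapping.single (0 :: bivar \<Rightarrow>\<^sub>0 nat) (c $ j)) 0 \<noteq> 0"
        by simp
      then show ?thesis
        by (metis lookup_zero vec_lambda_beta zero_index)
    qed
    moreover have "(\<chi> j. Poly_Mapping.single 0 (c $ j)) $ j \<in> bihom (0, 0)" for j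
      by (simp add: bihom_def bidegree_def)
    ultimately show ?thesis
      using lift_syzygy_bidegree[OF g g_nonzero c(2), of 0 n] by (auto simp: add.commute)
  qed
  moreover have "\<exists>M \<mu>. hilbert_burch_matrix h M \<and> \<mu> \<le> n - i \<and>
          column_of_degree M 0 (n - i - \<mu>) \<and> column_of_degree M 1 \<mu> \<and>
          syzygy_of_bidegree n (products g h) (lift_syzygy g (column 1 M)) (3, n + 2 * i + \<mu>) \<and>
          syzygy_of_bidegree n (products g h) (lift_syzygy g (column 0 M)) (3, 2 * n + i - \<mu>)"
  proof -
    obtain N N' where "var Var_u ^ N \<in> uv_ideal h" "var Var_v ^ N' \<in> uv_ideal h"
      using var_power_in_uv_ideal[OF bpf h_uv] by (metis insertCI)
    then obtain M \<mu> where M: "hilbert_burch_matrix h M" and "\<mu> \<le> n - i"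
      and deg: "column_of_degree M 0 (n - i - \<mu>)" "column_of_degree M 1 \<mu>"
      and syz: "\<And>k. syzygy h (column k M)" and nonzero: "\<And>k. column k M \<noteq> 0"
      using hilbert_burch_exists[OF h] by metis
    have "column 0 M $ j \<in> bihom (0, n - i - \<mu>)" "column 1 M $ j \<in> bihom (0, \<mu>)" for j
      using deg by (auto simp: column_of_degree_def uv_forms_def)
    then have "syzygy_of_bidegree n (products g h) (lift_syzygy g (column 1 M)) (3, n + 2 * i + \<mu>)"
      "syzygy_of_bidegree n (products g h) (lift_syzygy g (column 0 M)) (3, n + 2 * i + (n - i - \<mu>))"
      using lift_syzygy_bidegree[OF g g_nonzero syz nonzero] by blast+
    moreover have "n + 2 * i + (n - i - \<mu>) = 2 * n + i - \<mu>"
      using \<open>\<mu> \<le> n - i\<close> i n by linarith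
    ultimately show ?thesis
      using M \<open>\<mu> \<le> n - i\<close> deg by metis
  qed
  ultimately show ?thesis
    using syzygy_lift[of h _ g] syzygy_lift[of g _ h] by (simp add: products_commute[of h g])
qed

end
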